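(* Let $k_1,k_2$ be integers with $k_1\neq0$, $k_2\neq0$, $k_1\neq k_2$. Suppose that the $C^*$-dynamical system $(\mathfrak A,\alpha,\omega)$ is compact, i.e. $\mathcal H_\omega$ is generated (as a closed subspace) by the eigenvectors of $U_\omega$. Then for each $A\in\mathcal B(\mathcal H_\omega)$, $$\mathop{\rm s\text{-}lim}_{N\to+\infty}\frac1N\sum_{n=0}^{N-1}U_\omega^{nk_1}AU_\omega^{n(k_2-k_1)}=S(A),$$ where the limit is in the strong operator topology and $$S(A)=\sum_{\{v,w\in\sigma_{\rm pp}(U_\omega)\,\mid\, v^{k_1}w^{k_2-k_1}=1\}}E^{U_\omega}_vAE^{U_\omega}_w,$$ the series converging in the strong operator topology.
   Context: A (discrete) $C^*$-dynamical system $(\mathfrak A,\alpha,\omega)$ consists of a unital $C^*$-algebra $\mathfrak A$, a $*$-automorphism $\alpha$, and a state $\omega$ with $\omega\circ\alpha=\omega$. $(\mathcal H_\omega,\pi_\omega,U_\omega,\Omega)$ is the covariant GNS representation: $\omega(A)=\langle\pi_\omega(A)\Omega,\Omega\rangle$, $U_\omega$ unitary, $U_\omega\Omega=\Omega$, $U_\omega\pi_\omega(A)U_\omega^*=\pi_\omega(\alpha(A))$. $\sigma_{\rm pp}(U_\omega)$ is the set of eigenvalues of $U_\omega$, and $E^{U_\omega}_z$ is the orthogonal projection onto the eigenspace of $U_\omega$ for $z\in\mathbb T$. *)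

theory Defs
  imports "HOL-Analysis.Analysis"
begin

section \<open>Complex Hilbert spaces and unital C*-algebras\<close>

class complex_normed_vector = real_normed_vector +
  fixes scaleC :: "complex \<Rightarrow> 'a \<Rightarrow> 'a"  (infixr \<open>*\<^sub>C\<close> 75)
  assumes scaleC_add_right: "c *\<^sub>C (x + y) = c *\<^sub>C x + c *\<^sub>C y"
    and scaleC_add_left: "(c + d) *\<^sub>C x = c *\<^sub>C x + d *\<^sub>C x"
    and scaleC_scaleC: "c *\<^sub>C d *\<^sub>C x = (c * d) *\<^sub>C x"
    and scaleR_scaleC: "r *\<^sub>R x = complex_of_real r *\<^sub>C x"
    and norm_scaleC: "norm (c *\<^sub>C x) = cmod c * norm x"

(* The inner product is linear in its first and antilinear in its second argument.
   Positive definiteness follows from cinner_self because norm is a norm. *)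
class complex_hilbert = complex_normed_vector + complete_space +
  fixes cinner :: "'a \<Rightarrow> 'a \<Rightarrow> complex"
  assumes cinner_add_left: "cinner (x + y) z = cinner x z + cinner y z"
    and cinner_scaleC_left: "cinner (c *\<^sub>C x) y = c * cinner x y"
    and cinner_commute: "cinner y x = cnj (cinner x y)"
    and cinner_self: "cinner x x = complex_of_real ((norm x)\<^sup>2)"

class unital_cstar_algebra = complex_normed_vector + real_normed_algebra_1 + complete_space +
  fixes star :: "'a \<Rightarrow> 'a"
  assumes mult_scaleC_left: "(c *\<^sub>C x) * y = c *\<^sub>C (x * y)"
    and mult_scaleC_right: "x * (c *\<^sub>C y) = c *\<^sub>C (x * y)"
    and star_add: "star (x + y) = star x + star y"
    and star_scaleC: "star (c *\<^sub>C x) = cnj c *\<^sub>C star x"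
    and star_mult: "star (x * y) = star y * star x"
    and star_star: "star (star x) = x"
    and cstar_identity: "norm (star x * x) = (norm x)\<^sup>2"


section \<open>Dynamical systems\<close>

definition star_automorphism :: "('a::unital_cstar_algebra \<Rightarrow> 'a) \<Rightarrow> bool" where
  "star_automorphism \<alpha> \<longleftrightarrow> bij \<alpha>
     \<and> (\<forall>a b. \<alpha> (a + b) = \<alpha> a + \<alpha> b) \<and> (\<forall>c a. \<alpha> (c *\<^sub>C a) = c *\<^sub>C \<alpha> a)
     \<and> (\<forall>a b. \<alpha> (a * b) = \<alpha> a * \<alpha> b) \<and> (\<forall>a. \<alpha> (star a) = star (\<alpha> a))"

definition cstar_state :: "('a::unital_cstar_algebra \<Rightarrow> complex) \<Rightarrow> bool" where
  "cstar_state \<omega> \<longleftrightarrow> (\<forall>a b. \<omega> (a + b) = \<omega> a + \<omega> b) \<and> (\<forall>c a. \<omega> (c *\<^sub>C a) = c * \<omega> a)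
     \<and> (\<forall>a. \<omega> (star a * a) \<in> \<real>\<^sub>\<ge>\<^sub>0) \<and> \<omega> 1 = 1"

definition cstar_dynamical_system ::
    "('a::unital_cstar_algebra \<Rightarrow> 'a) \<Rightarrow> ('a \<Rightarrow> complex) \<Rightarrow> bool" where
  "cstar_dynamical_system \<alpha> \<omega> \<longleftrightarrow>
     star_automorphism \<alpha> \<and> cstar_state \<omega> \<and> (\<forall>a. \<omega> (\<alpha> a) = \<omega> a)"


section \<open>Operators on a Hilbert space\<close>

(* Blinfuns are only real-linear; B(H) is the set of those that are complex-linear. *)
definition bounded_ops :: "('h::complex_hilbert \<Rightarrow>\<^sub>L 'h) set" where
  "bounded_ops = {T. \<forall>c x. blinfun_apply T (c *\<^sub>C x) = c *\<^sub>C blinfun_apply T x}"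

definition cadjoint :: "('h::complex_hilbert \<Rightarrow>\<^sub>L 'h) \<Rightarrow> ('h \<Rightarrow>\<^sub>L 'h)" where
  "cadjoint T = (THE S. \<forall>x y. cinner (blinfun_apply T x) y = cinner x (blinfun_apply S y))"

definition unitary_op :: "('h::complex_hilbert \<Rightarrow>\<^sub>L 'h) \<Rightarrow> bool" where
  "unitary_op U \<longleftrightarrow> U \<in> bounded_ops \<and> surj (blinfun_apply U)
     \<and> (\<forall>x y. cinner (blinfun_apply U x) (blinfun_apply U y) = cinner x y)"

(* Integer powers of a unitary; negative powers are powers of the inverse, i.e. of the adjoint. *)
definition op_powi :: "('h::complex_hilbert \<Rightarrow>\<^sub>L 'h) \<Rightarrow> int \<Rightarrow> ('h \<Rightarrow>\<^sub>L 'h)" where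
  "op_powi U k =
     (if k \<ge> 0 then ((\<lambda>T. U o\<^sub>L T) ^^ nat k) id_blinfun
      else ((\<lambda>T. cadjoint U o\<^sub>L T) ^^ nat (- k)) id_blinfun)"

definition eigenspace :: "('h::complex_hilbert \<Rightarrow>\<^sub>L 'h) \<Rightarrow> complex \<Rightarrow> 'h set" where
  "eigenspace U z = {x. blinfun_apply U x = z *\<^sub>C x}"

definition sigma_pp :: "('h::complex_hilbert \<Rightarrow>\<^sub>L 'h) \<Rightarrow> complex set" where
  "sigma_pp U = {z. \<exists>x. x \<noteq> 0 \<and> x \<in> eigenspace U z}"

(* Meant for closed complex subspaces M, for which existence is the projection theorem. *)
definition orth_proj :: "'h::complex_hilbert set \<Rightarrow> ('h \<Rightarrow>\<^sub>L 'h)" where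
  "orth_proj M = (THE P. \<forall>x. blinfun_apply P x \<in> M
     \<and> (\<forall>y\<in>M. cinner (x - blinfun_apply P x) y = 0))"

definition eigenproj :: "('h::complex_hilbert \<Rightarrow>\<^sub>L 'h) \<Rightarrow> complex \<Rightarrow> ('h \<Rightarrow>\<^sub>L 'h)" where
  "eigenproj U z = orth_proj (eigenspace U z)"

definition csubspace :: "'h::complex_hilbert set \<Rightarrow> bool" where
  "csubspace M \<longleftrightarrow>
     0 \<in> M \<and> (\<forall>x\<in>M. \<forall>y\<in>M. x + y \<in> M) \<and> (\<forall>c. \<forall>x\<in>M. c *\<^sub>C x \<in> M)"

definition closed_cspan :: "'h::complex_hilbert set \<Rightarrow> 'h set" where
  "closed_cspan X = (\<lambda>M. csubspace M \<and> closed M) hull X"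

(* Convergence of the net of finite partial sums; the index set may be uncountable. *)
definition sot_has_sum ::
    "('i \<Rightarrow> ('h::complex_hilbert \<Rightarrow>\<^sub>L 'h)) \<Rightarrow> 'i set \<Rightarrow> ('h \<Rightarrow>\<^sub>L 'h) \<Rightarrow> bool" where
  "sot_has_sum f I S \<longleftrightarrow>
     limitin strong_operator_topology (sum f) S (finite_subsets_at_top I)"


section \<open>The covariant GNS representation\<close>

(* These properties, including cyclicity of Omega, determine the quadruple up to unitary
   equivalence. *)
definition covariant_GNS ::
    "('a::unital_cstar_algebra \<Rightarrow> 'a) \<Rightarrow> ('a \<Rightarrow> complex) \<Rightarrow>
     ('a \<Rightarrow> ('h::complex_hilbert \<Rightarrow>\<^sub>L 'h)) \<Rightarrow> ('h \<Rightarrow>\<^sub>L 'h) \<Rightarrow> 'h \<Rightarrow> bool" where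
  "covariant_GNS \<alpha> \<omega> \<pi> U \<Omega> \<longleftrightarrow>
     (\<forall>a. \<pi> a \<in> bounded_ops)
     \<and> (\<forall>a b. \<pi> (a + b) = \<pi> a + \<pi> b)
     \<and> (\<forall>c a x. blinfun_apply (\<pi> (c *\<^sub>C a)) x = c *\<^sub>C blinfun_apply (\<pi> a) x)
     \<and> (\<forall>a b. \<pi> (a * b) = \<pi> a o\<^sub>L \<pi> b)
     \<and> \<pi> 1 = id_blinfun
     \<and> (\<forall>a x y. cinner (blinfun_apply (\<pi> a) x) y = cinner x (blinfun_apply (\<pi> (star a)) y))
     \<and> closure (range (\<lambda>a. blinfun_apply (\<pi> a) \<Omega>)) = UNIV
     \<and> (\<forall>a. \<omega> a = cinner (blinfun_apply (\<pi> a) \<Omega>) \<Omega>)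
     \<and> unitary_op U
     \<and> blinfun_apply U \<Omega> = \<Omega>
     \<and> (\<forall>a. U o\<^sub>L \<pi> a o\<^sub>L cadjoint U = \<pi> (\<alpha> a))"

definition compact_system :: "('h::complex_hilbert \<Rightarrow>\<^sub>L 'h) \<Rightarrow> bool" where
  "compact_system U \<longleftrightarrow> closed_cspan {x. x \<noteq> 0 \<and> (\<exists>z. x \<in> eigenspace U z)} = UNIV"

end

theory Submission
  imports Defs
begin

text \<open>Both nets of operators are uniformly bounded, so strong convergence and equality of the limits
  need only be tested on the eigenvectors, which form a total set. On an eigenvector x with
  eigenvalue w the partial sums are eventually constant, and the n-th term of the mean is
  \<open>w\<close> to the power \<open>n (k2 - k1)\<close> times \<open>U\<close> to the power \<open>n k1\<close>
  applied to \<open>A x\<close>. These means are again tested on eigenvectors, where they are Cesaro means of powers of a unimodular number.\<close>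

section \<open>Complex-linear maps and the inner product\<close>

text \<open>The delicate point is the uniform bound for the double series. The constraint
  \<open>v powi k1 * w powi (k2 - k1) = 1\<close> with \<open>k1\<close> nonzero leaves each
  eigenvalue w at most \<open>\<bar>k1\<bar>\<close> partners v, and orthogonality of the
  eigenspaces turns this count into the bound \<open>norm A * sqrt \<bar>k1\<bar>\<close>,
  independent of the finite set of indices. The operator S is obtained as the limit of the series;
  the means are then compared with it. The spectrum may be uncountable, so the series is a net over
  finite sets, and the convergence results are stated for an arbitrary nontrivial filter in order to
  serve both this net and the sequence of means. Adjoints and eigenprojections are definite
  descriptions, so nothing is known about them until an operator with the defining property has been
  exhibited.\<close>

lemma scaleC_one [simp]: "1 *\<^sub>C x = (x::'a::complex_normed_vector)"
  using scaleR_scaleC[of 1 x] by simp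

lemma scaleC_zero_left [simp]: "0 *\<^sub>C x = (0::'a::complex_normed_vector)"
  using norm_scaleC[of 0 x] by simp

lemma scaleC_zero_right [simp]: "c *\<^sub>C 0 = (0::'a::complex_normed_vector)"
  using norm_scaleC[of c "0::'a"] by simp

lemma scaleR_scaleC_commute:
  "c *\<^sub>C (r *\<^sub>R x) = r *\<^sub>R (c *\<^sub>C (x::'a::complex_normed_vector))"
  by (simp add: scaleR_scaleC scaleC_scaleC mult.commute)

lemma bounded_linear_scaleC_right:
  "bounded_linear (\<lambda>x. c *\<^sub>C (x::'a::complex_normed_vector))"
  by (rule bounded_linear_intro[where K="cmod c"])
     (simp_all add: scaleC_add_right scaleR_scaleC_commute norm_scaleC mult.commute)

lemma bounded_linear_scaleC_left:
  "bounded_linear (\<lambda>c. c *\<^sub>C (x::'a::complex_normed_vector))"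
  by (rule bounded_linear_intro[where K="norm x"])
     (simp_all add: scaleC_add_left scaleR_scaleC scaleC_scaleC norm_scaleC scaleR_conv_of_real)

lemma scaleC_minus_left: "(c - d) *\<^sub>C x = c *\<^sub>C x - d *\<^sub>C (x::'a::complex_normed_vector)"
  by (rule linear_diff[OF bounded_linear.linear[OF bounded_linear_scaleC_left]])

lemma scaleC_sum_left: "(\<Sum>i\<in>I. f i) *\<^sub>C x = (\<Sum>i\<in>I. f i *\<^sub>C (x::'a::complex_normed_vector))"
  by (rule linear_sum[OF bounded_linear.linear[OF bounded_linear_scaleC_left]])

lemma scaleC_sum_right: "c *\<^sub>C (\<Sum>i\<in>I. f i) = (\<Sum>i\<in>I. c *\<^sub>C (f i::'a::complex_normed_vector))"
  by (rule linear_sum[OF bounded_linear.linear[OF bounded_linear_scaleC_right]])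

text \<open>Formulated for plain functions: the limits below arise pointwise, and become bounded
  operators only once their norm estimate is known. Blinfuns carry real linearity only.\<close>

definition complex_linear ::
    "('a::complex_normed_vector \<Rightarrow> 'b::complex_normed_vector) \<Rightarrow> bool" where
  "complex_linear f \<longleftrightarrow>
     (\<forall>x y. f (x + y) = f x + f y) \<and> (\<forall>c x. f (c *\<^sub>C x) = c *\<^sub>C f x)"

lemma complex_linear_add: "complex_linear f \<Longrightarrow> f (x + y) = f x + f y"
  and complex_linear_scaleC: "complex_linear f \<Longrightarrow> f (c *\<^sub>C x) = c *\<^sub>C f x"
  by (auto simp: complex_linear_def)

lemma complex_linear_imp_linear: "complex_linear f \<Longrightarrow> linear f"
  by (rule linearI) (auto simp: complex_linear_def scaleR_scaleC)

lemma complex_linear_imp_bounded_linear: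
  assumes "complex_linear f" "\<And>x. norm (f x) \<le> C * norm x"
  shows "bounded_linear f"
  by (rule bounded_linear_intro[where K=C])
     (use assms complex_linear_imp_linear[OF assms(1)] in
       \<open>auto simp: linear_add linear_scale mult.commute\<close>)

lemma complex_linear_sum:
  assumes "\<And>i. i \<in> I \<Longrightarrow> complex_linear (f i)"
  shows "complex_linear (\<lambda>x. \<Sum>i\<in>I. f i x)"
  using assms by (auto simp: complex_linear_def sum.distrib scaleC_sum_right)

lemma complex_linear_scaleR: "complex_linear f \<Longrightarrow> complex_linear (\<lambda>x. r *\<^sub>R f x)"
  by (auto simp: complex_linear_def scaleR_add_right scaleR_scaleC_commute)

lemma complex_linear_compose: "complex_linear f \<Longrightarrow> complex_linear g \<Longrightarrow> complex_linear (\<lambda>x. f (g x))"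
  by (auto simp: complex_linear_def)

lemma complex_linear_mult_scaleC: "complex_linear f \<Longrightarrow> complex_linear (\<lambda>x. c *\<^sub>C f x)"
  by (auto simp: complex_linear_def scaleC_add_right scaleC_scaleC mult.commute)

lemma bounded_ops_iff: "T \<in> bounded_ops \<longleftrightarrow> complex_linear (blinfun_apply T)"
  by (auto simp: bounded_ops_def complex_linear_def blinfun.add_right)

lemma bounded_ops_compose: "S \<in> bounded_ops \<Longrightarrow> T \<in> bounded_ops \<Longrightarrow> S o\<^sub>L T \<in> bounded_ops"
  by (simp add: bounded_ops_def)

lemma bounded_ops_sum: "(\<And>i. i \<in> I \<Longrightarrow> f i \<in> bounded_ops) \<Longrightarrow> sum f I \<in> bounded_ops"
  by (simp add: bounded_ops_def blinfun.sum_left scaleC_sum_right)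

lemma bounded_ops_scaleR: "T \<in> bounded_ops \<Longrightarrow> r *\<^sub>R T \<in> bounded_ops"
  by (simp add: bounded_ops_def blinfun.scaleR_left scaleR_scaleC_commute)

section \<open>Sesquilinearity, polarization and Bessel's inequality\<close>

lemma cinner_add_right: "cinner x (y + z) = cinner x y + cinner x (z::'h::complex_hilbert)"
  by (metis cinner_commute cinner_add_left complex_cnj_add)

lemma cinner_scaleC_right: "cinner x (c *\<^sub>C y) = cnj c * cinner x (y::'h::complex_hilbert)"
  by (metis cinner_commute cinner_scaleC_left complex_cnj_mult)

lemma cinner_zero_left [simp]: "cinner 0 (y::'h::complex_hilbert) = 0"
  using cinner_scaleC_left[of 0 0 y] by simp

lemma cinner_zero_right [simp]: "cinner (y::'h::complex_hilbert) 0 = 0"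
  using cinner_scaleC_right[of y 0 0] by simp

lemma cinner_minus_left: "cinner (- x) y = - cinner x (y::'h::complex_hilbert)"
  using cinner_add_left[of x "- x" y] by (simp add: add_eq_0_iff)

lemma cinner_diff_left: "cinner (x - y) z = cinner x z - cinner y (z::'h::complex_hilbert)"
  using cinner_add_left[of x "- y" z] by (simp add: cinner_minus_left)

lemma cinner_diff_right: "cinner z (x - y) = cinner z x - cinner z (y::'h::complex_hilbert)"
  by (metis cinner_commute cinner_diff_left complex_cnj_diff)

lemma cinner_sum_left: "cinner (\<Sum>i\<in>I. f i) y = (\<Sum>i\<in>I. cinner (f i) (y::'h::complex_hilbert))"
  by (induction I rule: infinite_finite_induct) (auto simp: cinner_add_left)

lemma cinner_sum_right: "cinner y (\<Sum>i\<in>I. f i) = (\<Sum>i\<in>I. cinner y (f i::'h::complex_hilbert))"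
  by (induction I rule: infinite_finite_induct) (auto simp: cinner_add_right)

lemma cinner_self_eq_0_iff: "cinner x x = 0 \<longleftrightarrow> x = (0::'h::complex_hilbert)"
  by (simp add: cinner_self)

lemma norm_add_sq:
  "(norm (x + y))\<^sup>2 = (norm x)\<^sup>2 + (norm y)\<^sup>2 + 2 * Re (cinner x (y::'h::complex_hilbert))"
proof -
  have "Re (cinner (x + y) (x + y)) = Re (cinner x x) + Re (cinner y y) + 2 * Re (cinner x y)"
    by (simp add: cinner_add_left cinner_add_right cinner_commute[of y x])
  then show ?thesis
    by (simp add: cinner_self)
qed

text \<open>Polarization expresses the real part through norms, which are continuous; the imaginary
  part at x is minus the real part at i x.\<close>

lemma continuous_on_cinner_left: "continuous_on UNIV (\<lambda>x. cinner x (y::'h::complex_hilbert))"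
proof -
  have re: "Re (cinner x y) = ((norm (x + y))\<^sup>2 - (norm x)\<^sup>2 - (norm y)\<^sup>2) / 2" for x
    using norm_add_sq[of x y] by simp
  have im: "Im (cinner x y) = - Re (cinner (\<i> *\<^sub>C x) y)" for x
    by (simp add: cinner_scaleC_left)
  have c_re: "continuous_on UNIV (\<lambda>x. Re (cinner x y))"
    unfolding re by (intro continuous_intros) simp
  have c_im: "continuous_on UNIV (\<lambda>x. Im (cinner x y))"
    unfolding im
    by (intro continuous_intros continuous_on_compose2[OF c_re]
        bounded_linear.continuous_on[OF bounded_linear_scaleC_right] subset_UNIV)
  have "(\<lambda>x. cinner x y) = (\<lambda>x. Complex (Re (cinner x y)) (Im (cinner x y)))"
    by simp
  then show ?thesis
    using continuous_on_Complex[OF c_re c_im] by simp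
qed

lemma norm_sum_orthogonal_sq:
  fixes f :: "'i \<Rightarrow> 'h::complex_hilbert"
  assumes "finite I" "\<And>i j. i \<in> I \<Longrightarrow> j \<in> I \<Longrightarrow> i \<noteq> j \<Longrightarrow> cinner (f i) (f j) = 0"
  shows "(norm (\<Sum>i\<in>I. f i))\<^sup>2 = (\<Sum>i\<in>I. (norm (f i))\<^sup>2)"
  using assms
proof (induction I rule: finite_induct)
  case (insert i I)
  have "cinner (f i) (\<Sum>i\<in>I. f i) = 0"
    unfolding cinner_sum_right using insert by (intro sum.neutral) auto
  then show ?case
    using insert by (simp add: norm_add_sq)
qed simp

text \<open>The hypotheses describe the f i as projections of x to pairwise orthogonal subspaces of
  any dimension, which is the form needed for eigenspaces. Then x - s is orthogonal to the sum s of
  the f i, and Pythagoras applies.\<close>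

lemma bessel_finite:
  fixes f :: "'i \<Rightarrow> 'h::complex_hilbert"
  assumes fin: "finite I" and orth: "\<And>i j. i \<in> I \<Longrightarrow> j \<in> I \<Longrightarrow> i \<noteq> j \<Longrightarrow> cinner (f i) (f j) = 0"
    and proj: "\<And>i. i \<in> I \<Longrightarrow> cinner (x - f i) (f i) = 0"
  shows "(\<Sum>i\<in>I. (norm (f i))\<^sup>2) \<le> (norm x)\<^sup>2"
proof -
  define s where "s = (\<Sum>i\<in>I. f i)"
  have "cinner (x - s) (f i) = 0" if "i \<in> I" for i
  proof -
    have "cinner s (f i) = (\<Sum>j\<in>I. if j = i then cinner (f i) (f i) else 0)"
      unfolding s_def cinner_sum_left using orth that by (intro sum.cong) auto
    then show ?thesis
      using fin that proj[OF that] by (simp add: cinner_diff_left)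
  qed
  then have "cinner (x - s) s = 0"
    by (subst (2) s_def) (simp add: cinner_sum_right)
  then have "(norm x)\<^sup>2 = (norm (x - s))\<^sup>2 + (norm s)\<^sup>2"
    using norm_add_sq[of "x - s" s] by simp
  then show ?thesis
    using norm_sum_orthogonal_sq[OF fin orth] by (simp add: s_def)
qed


section \<open>Strong limits from a total set\<close>

text \<open>The strong operator topology is the pullback of the product topology along
  \<open>blinfun_apply\<close>, so pointwise convergence suffices.\<close>

lemma limitin_strong_operator_topologyI:
  assumes "\<And>x. ((\<lambda>i. blinfun_apply (f i) x) \<longlongrightarrow> blinfun_apply l x) F"
  shows "limitin strong_operator_topology f l F"
proof -
  have "limitin (product_topology (\<lambda>_. euclidean) UNIV)
      (\<lambda>i. blinfun_apply (f i)) (blinfun_apply l) F"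
    using assms by (simp add: limitin_componentwise)
  then have "((\<lambda>i. blinfun_apply (f i)) \<longlongrightarrow> blinfun_apply l) F"
    by (simp add: euclidean_product_topology)
  then show ?thesis
    by (auto simp: limitin_def topspace_pullback_topology strong_operator_topology_def
        openin_pullback_topology tendsto_def)
qed

text \<open>An induction principle for total sets: a property that holds on D and whose extension is
  a closed subspace holds everywhere.\<close>

lemma csubspace_closed_UNIV:
  assumes "closed_cspan D = UNIV" "csubspace M" "closed M" "D \<subseteq> M"
  shows "M = UNIV"
  using hull_minimal[of D M "\<lambda>M. csubspace M \<and> closed M"] assms
  by (auto simp: closed_cspan_def)

lemma complex_linear_eq_on_total:
  fixes f g :: "'h::complex_hilbert \<Rightarrow> 'h"
  assumes D: "closed_cspan D = UNIV"
    and f: "complex_linear f" "bounded_linear f" and g: "complex_linear g" "bounded_linear g"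
    and eq: "\<And>x. x \<in> D \<Longrightarrow> f x = g x"
  shows "f x = g x"
proof -
  have "{x. f x = g x} = UNIV"
  proof (rule csubspace_closed_UNIV[OF D])
    show "csubspace {x. f x = g x}"
      using f g by (auto simp: csubspace_def complex_linear_def linear_simps)
    show "closed {x. f x = g x}"
      using f(2) g(2) by (intro closed_Collect_eq) (auto intro: linear_continuous_on)
  qed (use eq in auto)
  then show ?thesis by auto
qed

text \<open>The uniform bound makes the limits at X n a Cauchy sequence, and an e/3 argument
  identifies its limit as the limit at x. Closedness may be tested on sequences because the space is
  metric, although F itself is an arbitrary filter.\<close>

lemma closed_convergence_set:
  fixes T :: "'i \<Rightarrow> 'h::complex_hilbert \<Rightarrow> 'h"
  assumes F: "F \<noteq> bot" and T: "\<And>i. complex_linear (T i)"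
    and bd: "\<And>i x. norm (T i x) \<le> C * norm x"
  shows "closed {x. \<exists>l. ((\<lambda>i. T i x) \<longlongrightarrow> l) F}"
  unfolding closed_sequential_limits
proof (intro allI impI, elim conjE)
  fix X x
  assume X: "\<forall>n. X n \<in> {x. \<exists>l. ((\<lambda>i. T i x) \<longlongrightarrow> l) F}" and lim: "X \<longlonglongrightarrow> x"
  from X obtain L where L: "\<And>n. ((\<lambda>i. T i (X n)) \<longlongrightarrow> L n) F"
    by simp metis
  \<comment> \<open>Nothing is assumed about the sign of C; \<open>\<bar>C\<bar> + 1\<close> is a
    valid Lipschitz constant by which one can divide.\<close>
  have bd': "norm (T i x - T i y) \<le> (\<bar>C\<bar> + 1) * norm (x - y)" for i x y
  proof -
    have "norm (T i x - T i y) \<le> C * norm (x - y)"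
      using bd[of i "x - y"] complex_linear_imp_linear[OF T] by (simp add: linear_diff)
    also have "\<dots> \<le> (\<bar>C\<bar> + 1) * norm (x - y)"
      by (intro mult_right_mono) auto
    finally show ?thesis .
  qed
  have LL: "norm (L m - L n) \<le> (\<bar>C\<bar> + 1) * norm (X m - X n)" for m n
    by (rule tendsto_upperbound[OF tendsto_norm[OF tendsto_diff[OF L L]] _ F])
       (use bd' in auto)
  have "Cauchy L"
  proof (rule metric_CauchyI)
    fix e :: real assume "e > 0"
    then have "e / (\<bar>C\<bar> + 1) > 0" by simp
    with LIMSEQ_imp_Cauchy[OF lim] obtain M where
      M: "\<And>m n. m \<ge> M \<Longrightarrow> n \<ge> M \<Longrightarrow> dist (X m) (X n) < e / (\<bar>C\<bar> + 1)"
      unfolding Cauchy_def by meson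
    show "\<exists>M. \<forall>m\<ge>M. \<forall>n\<ge>M. dist (L m) (L n) < e"
    proof (intro exI allI impI)
      fix m n assume "m \<ge> M" "n \<ge> M"
      then have "(\<bar>C\<bar> + 1) * norm (X m - X n) < e"
        using M[of m n] by (simp add: dist_norm pos_less_divide_eq mult.commute)
      then show "dist (L m) (L n) < e"
        using LL[of m n] by (simp add: dist_norm)
    qed
  qed
  then obtain l where l: "L \<longlonglongrightarrow> l"
    by (meson Cauchy_convergent convergent_def)
  have "((\<lambda>i. T i x) \<longlongrightarrow> l) F"
  proof (rule tendstoI)
    fix e :: real assume e: "e > 0"
    then have "e / 3 / (\<bar>C\<bar> + 1) > 0" by simp
    then have "eventually (\<lambda>n. dist (X n) x < e / 3 / (\<bar>C\<bar> + 1)) sequentially"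
      using lim tendstoD by blast
    moreover have "eventually (\<lambda>n. dist (L n) l < e / 3) sequentially"
      using l e tendstoD[of L l _ "e / 3"] by simp
    ultimately obtain n where n: "dist (X n) x < e / 3 / (\<bar>C\<bar> + 1)" "dist (L n) l < e / 3"
      using eventually_happens[OF eventually_conj] by fastforce
    have *: "norm (T i x - T i (X n)) < e / 3" for i
    proof -
      have "(\<bar>C\<bar> + 1) * norm (x - X n) < e / 3"
        using n(1) by (simp add: dist_norm norm_minus_commute pos_less_divide_eq algebra_simps)
      then show ?thesis
        using bd'[of i x "X n"] by linarith
    qed
    have "eventually (\<lambda>i. dist (T i (X n)) (L n) < e / 3) F"
      using e by (intro tendstoD[OF L]) simp
    then show "eventually (\<lambda>i. dist (T i x) l < e) F"
    proof eventually_elim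
      case (elim i)
      have "dist (T i x) l \<le> dist (T i x) (T i (X n)) + dist (T i (X n)) (L n) + dist (L n) l"
        by (meson add_right_mono dist_triangle order_trans)
      then show ?case
        using *[of i] n(2) elim unfolding dist_norm by linarith
    qed
  qed
  then show "x \<in> {x. \<exists>l. ((\<lambda>i. T i x) \<longlongrightarrow> l) F}"
    by auto
qed

text \<open>No candidate for the limit is required: the vectors at which the net converges form a
  closed subspace containing D, and the pointwise limit inherits linearity and the bound C.\<close>

lemma strong_limit_exists:
  fixes T :: "'i \<Rightarrow> 'h::complex_hilbert \<Rightarrow> 'h"
  assumes F: "F \<noteq> bot" and T: "\<And>i. complex_linear (T i)"
    and bd: "\<And>i x. norm (T i x) \<le> C * norm x"
    and D: "closed_cspan D = UNIV"
    and conv: "\<And>x. x \<in> D \<Longrightarrow> \<exists>l. ((\<lambda>i. T i x) \<longlongrightarrow> l) F"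
  obtains S where "complex_linear S" "\<And>x. norm (S x) \<le> C * norm x"
    "\<And>x. ((\<lambda>i. T i x) \<longlongrightarrow> S x) F"
proof -
  have scale: "((\<lambda>i. T i (c *\<^sub>C x)) \<longlongrightarrow> c *\<^sub>C l) F" if "((\<lambda>i. T i x) \<longlongrightarrow> l) F" for c x l
    unfolding complex_linear_scaleC[OF T]
    by (rule bounded_linear.tendsto[OF bounded_linear_scaleC_right that])
  have add: "((\<lambda>i. T i (x + y)) \<longlongrightarrow> l + l') F"
    if "((\<lambda>i. T i x) \<longlongrightarrow> l) F" "((\<lambda>i. T i y) \<longlongrightarrow> l') F" for x y l l'
    unfolding complex_linear_add[OF T] by (rule tendsto_add[OF that])
  have "{x. \<exists>l. ((\<lambda>i. T i x) \<longlongrightarrow> l) F} = UNIV"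
  proof (rule csubspace_closed_UNIV[OF D])
    show "csubspace {x. \<exists>l. ((\<lambda>i. T i x) \<longlongrightarrow> l) F}"
      unfolding csubspace_def mem_Collect_eq
    proof (intro conjI ballI allI)
      show "\<exists>l. ((\<lambda>i. T i 0) \<longlongrightarrow> l) F"
        using linear_0[OF complex_linear_imp_linear[OF T]] by auto
    qed (use add scale in \<open>blast+\<close>)
  qed (use closed_convergence_set[OF F T bd] conv in auto)
  then have "\<forall>x. \<exists>l. ((\<lambda>i. T i x) \<longlongrightarrow> l) F"
    by blast
  then obtain S where S: "\<And>x. ((\<lambda>i. T i x) \<longlongrightarrow> S x) F"
    by metis
  show thesis
  proof
    show "complex_linear S"
      unfolding complex_linear_def
      using tendsto_unique[OF F S add[OF S S]] tendsto_unique[OF F S scale[OF S]] by blast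
    show "norm (S x) \<le> C * norm x" for x
      by (rule tendsto_upperbound[OF tendsto_norm[OF S] _ F]) (simp add: bd)
  qed (rule S)
qed

text \<open>The variant for a known candidate S. The limit exists by the preceding result and agrees
  with S on D, hence everywhere by continuity.\<close>

lemma strong_limit_from_total:
  fixes T :: "'i \<Rightarrow> 'h::complex_hilbert \<Rightarrow> 'h"
  assumes F: "F \<noteq> bot" and T: "\<And>i. complex_linear (T i)"
    and bd: "\<And>i x. norm (T i x) \<le> C * norm x"
    and D: "closed_cspan D = UNIV"
    and S: "complex_linear S" "bounded_linear S"
    and conv: "\<And>x. x \<in> D \<Longrightarrow> ((\<lambda>i. T i x) \<longlongrightarrow> S x) F"
  shows "((\<lambda>i. T i x) \<longlongrightarrow> S x) F"
proof -
  obtain S' where S': "complex_linear S'" "\<And>x. norm (S' x) \<le> C * norm x"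
    "\<And>x. ((\<lambda>i. T i x) \<longlongrightarrow> S' x) F"
    using strong_limit_exists[where T=T, OF F T bd D] conv by blast
  have "S' x = S x"
    using complex_linear_eq_on_total[OF D S'(1) complex_linear_imp_bounded_linear[OF S'(1,2)] S]
      tendsto_unique[OF F S'(3) conv] by blast
  then show ?thesis
    using S'(3)[of x] by simp
qed


section \<open>Powers and eigenprojections of a unitary\<close>

lemma unitary_norm: "unitary_op U \<Longrightarrow> norm (blinfun_apply U x) = norm x"
proof -
  assume "unitary_op U"
  then have "cinner (blinfun_apply U x) (blinfun_apply U x) = cinner x x"
    by (simp add: unitary_op_def)
  then have "(norm (blinfun_apply U x))\<^sup>2 = (norm x)\<^sup>2"
    by (simp only: cinner_self of_real_eq_iff)
  then show ?thesis by simp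
qed

text \<open>The inverse of U exists because U is a surjective isometry; it satisfies the adjoint
  equation, and positive definiteness makes the solution unique, which settles the description in
  \<open>cadjoint\<close>.\<close>

lemma unitary_cadjoint:
  assumes U: "unitary_op U"
  shows "cadjoint U \<in> bounded_ops" "blinfun_apply (cadjoint U) (blinfun_apply U x) = x"
    "blinfun_apply U (blinfun_apply (cadjoint U) x) = x"
proof -
  have lin: "complex_linear (blinfun_apply U)" and surj: "surj (blinfun_apply U)"
    using U by (auto simp: unitary_op_def bounded_ops_iff)
  have inj: "inj (blinfun_apply U)"
    using unitary_norm[OF U]
    by (intro injI) (metis blinfun.diff_right norm_eq_zero right_minus_eq)
  define V where "V = inv (blinfun_apply U)"
  have UV: "blinfun_apply U (V x) = x" for x
    using surj by (simp add: V_def surj_f_inv_f)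
  have VU: "V (blinfun_apply U x) = x" for x
    using inj by (simp add: V_def)
  have V: "complex_linear V"
    unfolding complex_linear_def
    by (metis UV VU complex_linear_add[OF lin] complex_linear_scaleC[OF lin])
  have nV: "norm (V x) \<le> 1 * norm x" for x
    using unitary_norm[OF U, of "V x"] by (simp add: UV)
  have BV: "blinfun_apply (Blinfun V) = V"
    by (rule bounded_linear_Blinfun_apply) (rule complex_linear_imp_bounded_linear[OF V nV])
  have adj: "cinner (blinfun_apply U x) y = cinner x (blinfun_apply (Blinfun V) y)" for x y
    using U UV[of y] unfolding unitary_op_def BV by metis
  have "cadjoint U = Blinfun V"
    unfolding cadjoint_def
  proof (rule the_equality)
    fix S :: "'a \<Rightarrow>\<^sub>L 'a"
    assume S: "\<forall>x y. cinner (blinfun_apply U x) y = cinner x (blinfun_apply S y)"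
    show "S = Blinfun V"
    proof (rule blinfun_eqI)
      fix y
      have "cinner x (blinfun_apply S y - blinfun_apply (Blinfun V) y) = 0" for x
        using S adj by (simp add: cinner_diff_right)
      then show "blinfun_apply S y = blinfun_apply (Blinfun V) y"
        by (metis cinner_self_eq_0_iff right_minus_eq)
    qed
  qed (use adj in blast)
  then show "cadjoint U \<in> bounded_ops" "blinfun_apply (cadjoint U) (blinfun_apply U x) = x"
    "blinfun_apply U (blinfun_apply (cadjoint U) x) = x"
    using V UV VU by (auto simp: bounded_ops_iff BV)
qed

lemma blinfun_compose_power_apply:
  fixes V :: "'a::real_normed_vector \<Rightarrow>\<^sub>L 'a"
  shows
  "blinfun_apply (((\<lambda>T. V o\<^sub>L T) ^^ n) id_blinfun) x = (blinfun_apply V ^^ n) x"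
  by (induction n) auto

lemma op_powi_apply:
  "blinfun_apply (op_powi U k) =
     (if k \<ge> 0 then blinfun_apply U ^^ nat k else blinfun_apply (cadjoint U) ^^ nat (- k))"
  by (auto simp: op_powi_def blinfun_compose_power_apply fun_eq_iff)

lemma complex_linear_funpow:
  fixes f :: "'a::complex_normed_vector \<Rightarrow> 'a"
  shows "complex_linear f \<Longrightarrow> complex_linear (f ^^ n)"
  by (induction n) (auto simp: complex_linear_def)

lemma complex_linear_op_powi: "unitary_op U \<Longrightarrow> complex_linear (blinfun_apply (op_powi U k))"
  unfolding op_powi_apply using unitary_cadjoint(1)[of U]
  by (auto simp: unitary_op_def bounded_ops_iff intro: complex_linear_funpow)

lemma funpow_isometry:
  fixes f :: "'a::real_normed_vector \<Rightarrow> 'a"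
  shows "(\<And>x. norm (f x) = norm x) \<Longrightarrow> norm ((f ^^ n) x) = norm x"
  by (induction n) auto

lemma norm_op_powi:
  assumes "unitary_op U"
  shows "norm (blinfun_apply (op_powi U k) x) = norm x"
proof -
  have "norm (blinfun_apply (cadjoint U) x) = norm x" for x
    using unitary_norm[OF assms, of "blinfun_apply (cadjoint U) x"] unitary_cadjoint(3)[OF assms]
    by simp
  then show ?thesis
    using unitary_norm[OF assms] by (auto simp: op_powi_apply intro: funpow_isometry)
qed

lemma funpow_eigenvector:
  fixes f :: "'a::complex_normed_vector \<Rightarrow> 'a"
  assumes "complex_linear f" "f x = z *\<^sub>C x"
  shows "(f ^^ n) x = z ^ n *\<^sub>C x"
  by (induction n) (use assms in \<open>auto simp: complex_linear_scaleC scaleC_scaleC mult.commute\<close>)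

lemma sigma_pp_norm:
  assumes "unitary_op U" "z \<in> sigma_pp U"
  shows "norm z = 1"
proof -
  from assms obtain x where "x \<noteq> 0" "blinfun_apply U x = z *\<^sub>C x"
    by (auto simp: sigma_pp_def eigenspace_def)
  then have "norm z * norm x = norm x"
    using unitary_norm[OF assms(1), of x] by (simp add: norm_scaleC)
  then show ?thesis
    using \<open>x \<noteq> 0\<close> by simp
qed

lemma sigma_pp_nonzero: "unitary_op U \<Longrightarrow> z \<in> sigma_pp U \<Longrightarrow> z \<noteq> 0"
  using sigma_pp_norm by fastforce

lemma op_powi_eigenvector:
  assumes U: "unitary_op U" and z: "z \<in> sigma_pp U" and x: "x \<in> eigenspace U z"
  shows "blinfun_apply (op_powi U k) x = (z powi k) *\<^sub>C x"
proof -
  have z0: "z \<noteq> 0"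
    using sigma_pp_nonzero[OF U z] .
  have lin: "complex_linear (blinfun_apply U)" "complex_linear (blinfun_apply (cadjoint U))"
    using U unitary_cadjoint(1)[OF U] by (auto simp: unitary_op_def bounded_ops_iff)
  have Ux: "blinfun_apply U x = z *\<^sub>C x"
    using x by (simp add: eigenspace_def)
  \<comment> \<open>Negative powers: applying the inverse to U x = z x shows that x is an
    eigenvector of \<open>cadjoint U\<close> for \<open>inverse z\<close>.\<close>
  have "x = blinfun_apply (cadjoint U) (z *\<^sub>C x)"
    using unitary_cadjoint(2)[OF U, of x] Ux by simp
  also have "\<dots> = z *\<^sub>C blinfun_apply (cadjoint U) x"
    by (rule complex_linear_scaleC[OF lin(2)])
  finally have "inverse z *\<^sub>C x = inverse z *\<^sub>C z *\<^sub>C blinfun_apply (cadjoint U) x"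
    by simp
  then have Vx: "blinfun_apply (cadjoint U) x = inverse z *\<^sub>C x"
    using z0 by (simp add: scaleC_scaleC)
  show ?thesis
    using funpow_eigenvector[OF lin(1) Ux] funpow_eigenvector[OF lin(2) Vx]
    by (auto simp: op_powi_apply power_int_def)
qed

lemma csubspace_eigenspace:
  assumes "unitary_op U"
  shows "csubspace (eigenspace U z)"
proof -
  have "complex_linear (blinfun_apply U)"
    using assms by (auto simp: unitary_op_def bounded_ops_iff)
  then show ?thesis
    by (auto simp: csubspace_def eigenspace_def complex_linear_def scaleC_add_right scaleC_scaleC
        mult.commute)
qed

lemma eigenspace_orthogonal:
  assumes U: "unitary_op U" and v: "v \<in> sigma_pp U" and neq: "v \<noteq> w"
    and x: "x \<in> eigenspace U v" and y: "y \<in> eigenspace U w"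
  shows "cinner x y = 0"
proof (rule ccontr)
  assume nz: "cinner x y \<noteq> 0"
  \<comment> \<open>A nonzero y makes w an eigenvalue, hence of modulus 1; together with v cnj w = 1
    this forces v = w.\<close>
  then have "y \<noteq> 0" by auto
  with y have w: "w \<in> sigma_pp U"
    by (auto simp: sigma_pp_def)
  have "cinner x y = cinner (blinfun_apply U x) (blinfun_apply U y)"
    using U by (simp add: unitary_op_def)
  also have "\<dots> = v * cnj w * cinner x y"
    using x y by (simp add: eigenspace_def cinner_scaleC_left cinner_scaleC_right)
  finally have "v * cnj w = 1"
    using nz by simp
  then have "w = v * (cnj w * w)"
    by (metis mult.assoc mult_1)
  also have "cnj w * w = 1"
    using sigma_pp_norm[OF U w] complex_norm_square[of w] by (simp add: mult.commute)
  finally show False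
    using neq by simp
qed

text \<open>Uniqueness in the definite description: the difference of two candidates at x lies in M
  and is orthogonal to M, so it vanishes. Existence is supplied by P.\<close>

lemma orth_proj_eqI:
  assumes M: "csubspace M"
    and P: "\<And>x. blinfun_apply P x \<in> M" "\<And>x y. y \<in> M \<Longrightarrow> cinner (x - blinfun_apply P x) y = 0"
  shows "orth_proj M = P"
  unfolding orth_proj_def
proof (rule the_equality)
  fix Q assume Q: "\<forall>x. blinfun_apply Q x \<in> M \<and> (\<forall>y\<in>M. cinner (x - blinfun_apply Q x) y = 0)"
  show "Q = P"
  proof (rule blinfun_eqI)
    fix x
    define d where "d = blinfun_apply Q x - blinfun_apply P x"
    \<comment> \<open>\<open>csubspace\<close> speaks of sums and scalar multiples only, so the
      difference is rewritten in these terms.\<close>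
    have "d = blinfun_apply Q x + (-1) *\<^sub>C blinfun_apply P x"
      by (simp add: d_def scaleC_minus_left[of 0 1, simplified])
    then have "d \<in> M"
      using M P(1) Q unfolding csubspace_def by metis
    then have "cinner ((x - blinfun_apply P x) - (x - blinfun_apply Q x)) d = 0"
      using P(2) Q by (simp only: cinner_diff_left[of "x - blinfun_apply P x"]) simp
    then have "cinner d d = 0"
      by (simp add: d_def)
    then show "blinfun_apply Q x = blinfun_apply P x"
      by (simp add: cinner_self_eq_0_iff d_def)
  qed
qed (use P in blast)

text \<open>For q different from 1 the geometric sums stay bounded by 2 / |q - 1|, so division by N
  sends them to 0.\<close>

lemma cesaro_mean_unimodular_power:
  fixes q :: complex
  assumes "norm q = 1"
  shows "(\<lambda>N. (1 / real N) *\<^sub>R (\<Sum>n<N. q ^ n)) \<longlonglongrightarrow> (if q = 1 then 1 else 0)"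
proof (cases "q = 1")
  case True
  \<comment> \<open>At N = 0 division by zero makes the mean 0; the equality holds from N = 1
    on.\<close>
  have "eventually (\<lambda>N. (1 / real N) *\<^sub>R (\<Sum>n<N. q ^ n) = 1) sequentially"
    using eventually_gt_at_top[of 0]
    by eventually_elim (simp add: True scaleR_conv_of_real)
  then show ?thesis
    using True by (simp add: tendsto_eventually)
next
  case False
  have le: "norm ((1 / real N) *\<^sub>R (\<Sum>n<N. q ^ n)) \<le> (2 / norm (q - 1)) * inverse (real N)" for N
  proof -
    have "norm (q ^ N - 1) \<le> norm (q ^ N) + 1"
      using norm_triangle_ineq4[of "q ^ N" 1] by simp
    then have "norm ((q ^ N - 1) / (q - 1)) \<le> 2 / norm (q - 1)"
      using assms by (simp add: norm_divide norm_power divide_right_mono)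
    then show ?thesis
      using False by (simp add: geometric_sum divide_inverse mult_left_mono mult.commute)
  qed
  have "(\<lambda>N. (2 / norm (q - 1)) * inverse (real N)) \<longlonglongrightarrow> 0"
    by (intro tendsto_mult_right_zero lim_inverse_n)
  then have "(\<lambda>N. (1 / real N) *\<^sub>R (\<Sum>n<N. q ^ n)) \<longlonglongrightarrow> 0"
    by (rule Lim_null_comparison[OF always_eventually[OF allI[OF le]]])
  then show ?thesis
    using False by simp
qed

section \<open>Means of twisted powers of a unitary\<close>

abbreviation eigenvectors :: "('h::complex_hilbert \<Rightarrow>\<^sub>L 'h) \<Rightarrow> 'h set" where
  "eigenvectors U \<equiv> {x. x \<noteq> 0 \<and> (\<exists>z. x \<in> eigenspace U z)}"

lemma eigenvectorsE:
  assumes "x \<in> eigenvectors U"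
  obtains z where "z \<in> sigma_pp U" "x \<in> eigenspace U z"
  using assms by (auto simp: sigma_pp_def)

lemma norm_cesaro_mean_le:
  assumes "\<And>n. norm (f n) \<le> b" "0 \<le> b"
  shows "norm ((1 / real N) *\<^sub>R (\<Sum>n<N. f n)) \<le> b"
proof -
  have "norm (\<Sum>n<N. f n) \<le> real N * b"
    using sum_norm_bound[of "{..<N}" f b] assms by simp
  then have "(1 / real N) * norm (\<Sum>n<N. f n) \<le> (1 / real N) * (real N * b)"
    by (intro mult_left_mono) auto
  \<comment> \<open>Only an inequality, since for N = 0 the left side is 0; here
    \<open>0 \<le> b\<close> enters.\<close>
  also have "\<dots> \<le> b"
    using assms(2) by simp
  finally show ?thesis by simp
qed

text \<open>The unimodular twist c serves two purposes: c = \<open>inverse z\<close> with k = 1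
  produces the eigenprojection onto z, and c = \<open>w powi (k2 - k1)\<close> with k =
  \<open>k1\<close> arises from the means of the theorem on an eigenvector for w.\<close>

lemma twisted_cesaro_mean_eigenvector:
  assumes U: "unitary_op U" and c: "norm c = 1"
    and v: "v \<in> sigma_pp U" "x \<in> eigenspace U v"
  shows "(\<lambda>N. (1 / real N) *\<^sub>R (\<Sum>n<N. c ^ n *\<^sub>C blinfun_apply (op_powi U (int n * k)) x))
     \<longlonglongrightarrow> (if c * v powi k = 1 then x else 0)"
proof -
  have "c ^ n *\<^sub>C blinfun_apply (op_powi U (int n * k)) x = (c * v powi k) ^ n *\<^sub>C x" for n
    using op_powi_eigenvector[OF U v]
    by (simp add: scaleC_scaleC power_mult_distrib power_int_power' mult.commute)
  then have eq: "(1 / real N) *\<^sub>R (\<Sum>n<N. c ^ n *\<^sub>C blinfun_apply (op_powi U (int n * k)) x)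
      = ((1 / real N) *\<^sub>R (\<Sum>n<N. (c * v powi k) ^ n)) *\<^sub>C x" for N
    by (simp add: scaleC_sum_left[symmetric] scaleR_scaleC scaleC_scaleC scaleR_conv_of_real)
  have "norm (c * v powi k) = 1"
    using c sigma_pp_norm[OF U v(1)] by (simp add: norm_mult norm_power_int)
  from bounded_linear.tendsto[OF bounded_linear_scaleC_left[of x]
      cesaro_mean_unimodular_power[OF this]]
  show ?thesis
    unfolding eq by (cases "c * v powi k = 1") simp_all
qed

lemma complex_linear_twisted_cesaro_mean:
  assumes "unitary_op U"
  shows "complex_linear
    (\<lambda>x. (1 / real N) *\<^sub>R (\<Sum>n<N. c ^ n *\<^sub>C blinfun_apply (op_powi U (int n * k)) x))"
  by (intro complex_linear_scaleR complex_linear_sum complex_linear_mult_scaleC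
      complex_linear_op_powi[OF assms])

lemma norm_twisted_cesaro_mean:
  assumes "unitary_op U" "norm c = 1"
  shows "norm ((1 / real N) *\<^sub>R (\<Sum>n<N. c ^ n *\<^sub>C blinfun_apply (op_powi U (int n * k)) x))
     \<le> 1 * norm x"
  using assms by (intro norm_cesaro_mean_le) (simp_all add: norm_scaleC norm_power norm_op_powi)

text \<open>For a compact system the eigenprojection onto z is the strong limit of the means of
  \<open>z\<^sup>-\<^sup>n U\<^sup>n\<close>, so the projection theorem is not required.\<close>

lemma eigenproj_compact:
  assumes U: "unitary_op U" and cs: "compact_system U" and z: "z \<in> sigma_pp U"
  shows "eigenproj U z \<in> bounded_ops"
    and "blinfun_apply (eigenproj U z) x \<in> eigenspace U z"
    and "y \<in> eigenspace U z \<Longrightarrow> cinner (x - blinfun_apply (eigenproj U z) x) y = 0"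
proof -
  have D: "closed_cspan (eigenvectors U) = UNIV"
    using cs by (simp add: compact_system_def)
  have lU: "complex_linear (blinfun_apply U)"
    using U by (simp add: unitary_op_def bounded_ops_iff)
  have c: "norm (inverse z) = 1"
    using sigma_pp_norm[OF U z] by (simp add: norm_inverse)
  define T where "T = (\<lambda>N x. (1 / real N) *\<^sub>R
     (\<Sum>n<N. inverse z ^ n *\<^sub>C blinfun_apply (op_powi U (int n * 1)) x))"
  have T_eig: "(\<lambda>N. T N x) \<longlonglongrightarrow> (if v = z then x else 0)"
    if "v \<in> sigma_pp U" "x \<in> eigenspace U v" for v x
  proof -
    have "inverse z * v powi 1 = 1 \<longleftrightarrow> v = z"
      using sigma_pp_nonzero[OF U z] by (auto simp: field_simps)
    then show ?thesis
      using twisted_cesaro_mean_eigenvector[OF U c that, of 1] by (simp only: T_def)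
  qed
  have T_lin: "complex_linear (T N)" and T_bd: "norm (T N x) \<le> 1 * norm x" for N x
    unfolding T_def
    using complex_linear_twisted_cesaro_mean[OF U] norm_twisted_cesaro_mean[OF U c] by blast+
  have T_conv: "\<exists>l. (\<lambda>N. T N x) \<longlonglongrightarrow> l" if "x \<in> eigenvectors U" for x
    by (rule eigenvectorsE[OF that]) (use T_eig in blast)
  obtain P where P: "complex_linear P" "\<And>x. norm (P x) \<le> 1 * norm x" "\<And>x. (\<lambda>N. T N x) \<longlonglongrightarrow> P x"
    using strong_limit_exists[where T=T, OF sequentially_bot T_lin T_bd D T_conv] by blast
  have P_eig: "P x = (if v = z then x else 0)" if "v \<in> sigma_pp U" "x \<in> eigenspace U v" for v x
    using LIMSEQ_unique[OF P(3) T_eig[OF that]] .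
  have bP: "bounded_linear P"
    by (rule complex_linear_imp_bounded_linear[OF P(1,2)])
  \<comment> \<open>The identity U P = z P is tested on eigenvectors, where both sides vanish unless
    the eigenvalue is z.\<close>
  have in_eig: "P x \<in> eigenspace U z" for x
  proof -
    have "blinfun_apply U (P x) = z *\<^sub>C P x"
    proof (rule complex_linear_eq_on_total[where f="\<lambda>x. blinfun_apply U (P x)"
          and g="\<lambda>x. z *\<^sub>C P x", OF D])
      show "complex_linear (\<lambda>x. blinfun_apply U (P x))" "complex_linear (\<lambda>x. z *\<^sub>C P x)"
        using P(1) lU by (auto intro: complex_linear_compose complex_linear_mult_scaleC)
      show "bounded_linear (\<lambda>x. blinfun_apply U (P x))" "bounded_linear (\<lambda>x. z *\<^sub>C P x)"
        using bP bounded_linear_compose bounded_linear_scaleC_right blinfun.bounded_linear_right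
        by blast+
      show "blinfun_apply U (P x) = z *\<^sub>C P x" if "x \<in> eigenvectors U" for x
        using that by (rule eigenvectorsE) (auto simp: P_eig eigenspace_def)
    qed
    then show ?thesis
      by (simp add: eigenspace_def)
  qed
  have orth: "cinner (x - P x) y = 0" if y: "y \<in> eigenspace U z" for x y
  proof -
    \<comment> \<open>With y fixed this is a condition on x alone that defines a closed subspace. An
      eigenvector for z satisfies it because P fixes it, any other because it is orthogonal to
      y.\<close>
    have "{x. cinner (x - P x) y = 0} = UNIV"
    proof (rule csubspace_closed_UNIV[OF D])
      show "csubspace {x. cinner (x - P x) y = 0}"
        using P(1) linear_0[OF complex_linear_imp_linear[OF P(1)]]
        by (auto simp: csubspace_def complex_linear_def cinner_diff_left cinner_add_left
            cinner_scaleC_left algebra_simps)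
      show "closed {x. cinner (x - P x) y = 0}"
        by (intro closed_Collect_eq continuous_on_const
            continuous_on_compose2[OF continuous_on_cinner_left] continuous_on_diff
            continuous_on_id linear_continuous_on[OF bP] subset_UNIV)
      show "eigenvectors U \<subseteq> {x. cinner (x - P x) y = 0}"
      proof
        fix x assume "x \<in> eigenvectors U"
        then obtain v where v: "v \<in> sigma_pp U" "x \<in> eigenspace U v"
          by (rule eigenvectorsE)
        show "x \<in> {x. cinner (x - P x) y = 0}"
          using P_eig[OF v] eigenspace_orthogonal[OF U v(1) _ v(2) y] by auto
      qed
    qed
    then show ?thesis by auto
  qed
  have BP: "blinfun_apply (Blinfun P) = P"
    by (rule bounded_linear_Blinfun_apply[OF bP])
  have "eigenproj U z = Blinfun P"
    unfolding eigenproj_def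
    by (rule orth_proj_eqI[OF csubspace_eigenspace[OF U]]) (use in_eig orth in \<open>auto simp: BP\<close>)
  then show "eigenproj U z \<in> bounded_ops"
    "blinfun_apply (eigenproj U z) x \<in> eigenspace U z"
    "y \<in> eigenspace U z \<Longrightarrow> cinner (x - blinfun_apply (eigenproj U z) x) y = 0"
    using P(1) in_eig orth by (auto simp: bounded_ops_iff BP)
qed

text \<open>If v = z, then x minus its projection lies in the eigenspace and is orthogonal to it.
  Otherwise the projection of x is orthogonal both to x and to x minus itself, hence to
  itself.\<close>

lemma eigenproj_eigenvector:
  assumes U: "unitary_op U" and cs: "compact_system U" and z: "z \<in> sigma_pp U"
    and v: "v \<in> sigma_pp U" "x \<in> eigenspace U v"
  shows "blinfun_apply (eigenproj U z) x = (if v = z then x else 0)"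
proof (cases "v = z")
  case True
  let ?d = "x - blinfun_apply (eigenproj U z) x"
  have "?d = x + (-1) *\<^sub>C blinfun_apply (eigenproj U z) x"
    by (simp add: scaleC_minus_left[of 0 1, simplified])
  then have "?d \<in> eigenspace U z"
    using csubspace_eigenspace[OF U, of z] v True eigenproj_compact(2)[OF U cs z]
    unfolding csubspace_def by metis
  then have "cinner ?d ?d = 0"
    by (rule eigenproj_compact(3)[OF U cs z])
  then show ?thesis
    using True by (simp add: cinner_self_eq_0_iff)
next
  case False
  let ?p = "blinfun_apply (eigenproj U z) x"
  have p: "?p \<in> eigenspace U z"
    by (rule eigenproj_compact(2)[OF U cs z])
  have "cinner (x - ?p) ?p = 0" "cinner x ?p = 0"
    using eigenproj_compact(3)[OF U cs z p] eigenspace_orthogonal[OF U v(1) False v(2) p] by auto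
  then have "cinner ?p ?p = 0"
    by (simp add: cinner_diff_left)
  then show ?thesis
    using False by (simp add: cinner_self_eq_0_iff)
qed

lemma eigenproj_orthogonal:
  assumes "unitary_op U" "compact_system U" "v \<in> sigma_pp U" "w \<in> sigma_pp U" "v \<noteq> w"
  shows "cinner (blinfun_apply (eigenproj U v) x) (blinfun_apply (eigenproj U w) y) = 0"
  using assms eigenspace_orthogonal eigenproj_compact(2) by metis

lemma eigenproj_bessel:
  assumes "unitary_op U" "compact_system U" "finite W" "W \<subseteq> sigma_pp U"
  shows "(\<Sum>w\<in>W. (norm (blinfun_apply (eigenproj U w) x))\<^sup>2) \<le> (norm x)\<^sup>2"
proof (rule bessel_finite[OF assms(3)])
  fix w assume "w \<in> W"
  then have w: "w \<in> sigma_pp U"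
    using assms(4) by blast
  show "cinner (x - blinfun_apply (eigenproj U w) x) (blinfun_apply (eigenproj U w) x) = 0"
    by (rule eigenproj_compact(3)[OF assms(1,2) w eigenproj_compact(2)[OF assms(1,2) w]])
next
  fix v w assume "v \<in> W" "w \<in> W" "v \<noteq> w"
  then show "cinner (blinfun_apply (eigenproj U v) x) (blinfun_apply (eigenproj U w) x) = 0"
    using assms(4) by (intro eigenproj_orthogonal[OF assms(1,2)]) auto
qed

lemma norm_eigenproj_le:
  assumes "unitary_op U" "compact_system U" "w \<in> sigma_pp U"
  shows "norm (blinfun_apply (eigenproj U w) x) \<le> norm x"
  using eigenproj_bessel[OF assms(1,2), of "{w}" x] assms(3) by (simp add: power2_le_iff_abs_le)


section \<open>Convergence of the double series and of the means\<close>

text \<open>A negative exponent is traded for a positive one by inverting c, which leaves the count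
  of complex roots of a nonzero number.\<close>

lemma finite_card_power_int_eq:
  fixes c :: complex
  assumes "k \<noteq> 0" "c \<noteq> 0"
  shows "finite {v. v powi k = c}" "card {v. v powi k = c} = nat \<bar>k\<bar>"
proof -
  have "{v. v powi k = c} = {v. v ^ nat \<bar>k\<bar> = (if k \<ge> 0 then c else inverse c)}"
    by (auto simp: power_int_def power_inverse)
  moreover have "nat \<bar>k\<bar> > 0" "(if k \<ge> 0 then c else inverse c) \<noteq> 0"
    using assms by auto
  ultimately show "finite {v. v powi k = c}" "card {v. v powi k = c} = nat \<bar>k\<bar>"
    using finite_nth_roots card_nth_roots by simp_all
qed

text \<open>The range components indexed by different v are orthogonal, and so are the domain
  components indexed by different w; since every w occurs at most K times, Bessel's inequality on
  both sides bounds all finite partial sums at once.\<close>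

lemma norm_sum_eigenproj_le:
  assumes U: "unitary_op U" and cs: "compact_system U"
    and F: "finite F" "F \<subseteq> sigma_pp U \<times> sigma_pp U"
    and K: "\<And>w. card {v. (v, w) \<in> F} \<le> K"
  shows "norm (\<Sum>(v, w)\<in>F. blinfun_apply (eigenproj U v o\<^sub>L A o\<^sub>L eigenproj U w) x)
     \<le> (norm A * sqrt (real K)) * norm x"
proof -
  let ?E = "\<lambda>z. blinfun_apply (eigenproj U z)"
  define V where "V = fst ` F"
  define W where "W = snd ` F"
  \<comment> \<open>F is sliced by its first coordinate: for fixed v the sum over w moves inside A,
    and what remains is a sum of pairwise orthogonal vectors.\<close>
  define G where "G = (\<lambda>v. {w\<in>W. (v, w) \<in> F})"
  have fin: "finite V" "finite W" "\<And>v. finite (G v)"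
    using F(1) by (auto simp: V_def W_def G_def)
  have sub: "V \<subseteq> sigma_pp U" "W \<subseteq> sigma_pp U"
    using F(2) by (auto simp: V_def W_def)
  have FV: "F = Sigma V G"
    by (force simp: V_def W_def G_def)
  define y where "y = (\<lambda>v. blinfun_apply A (\<Sum>w\<in>G v. ?E w x))"
  have "(\<Sum>(v, w)\<in>F. blinfun_apply (eigenproj U v o\<^sub>L A o\<^sub>L eigenproj U w) x)
      = (\<Sum>v\<in>V. \<Sum>w\<in>G v. ?E v (blinfun_apply A (?E w x)))"
    unfolding FV using fin by (subst sum.Sigma) auto
  also have "\<dots> = (\<Sum>v\<in>V. ?E v (y v))"
    by (simp add: y_def blinfun.sum_right)
  finally have eq: "(\<Sum>(v, w)\<in>F. blinfun_apply (eigenproj U v o\<^sub>L A o\<^sub>L eigenproj U w) x)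
      = (\<Sum>v\<in>V. ?E v (y v))" .
  have "(norm (\<Sum>v\<in>V. ?E v (y v)))\<^sup>2 = (\<Sum>v\<in>V. (norm (?E v (y v)))\<^sup>2)"
    using fin sub by (intro norm_sum_orthogonal_sq eigenproj_orthogonal[OF U cs]) auto
  also have "\<dots> \<le> (\<Sum>v\<in>V. (norm A)\<^sup>2 * (\<Sum>w\<in>G v. (norm (?E w x))\<^sup>2))"
  proof (rule sum_mono)
    fix v assume v: "v \<in> V"
    have "norm (?E v (y v)) \<le> norm (y v)"
      using sub v by (intro norm_eigenproj_le[OF U cs]) auto
    also have "\<dots> \<le> norm A * norm (\<Sum>w\<in>G v. ?E w x)"
      unfolding y_def by (rule norm_blinfun)
    finally have "(norm (?E v (y v)))\<^sup>2 \<le> (norm A * norm (\<Sum>w\<in>G v. ?E w x))\<^sup>2"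
      by (intro power_mono) auto
    also have "\<dots> = (norm A)\<^sup>2 * (\<Sum>w\<in>G v. (norm (?E w x))\<^sup>2)"
    proof -
      have "(norm (\<Sum>w\<in>G v. ?E w x))\<^sup>2 = (\<Sum>w\<in>G v. (norm (?E w x))\<^sup>2)"
        using fin sub
        by (intro norm_sum_orthogonal_sq eigenproj_orthogonal[OF U cs]) (auto simp: G_def)
      then show ?thesis
        by (simp add: power_mult_distrib)
    qed
    finally show "(norm (?E v (y v)))\<^sup>2 \<le> (norm A)\<^sup>2 * (\<Sum>w\<in>G v. (norm (?E w x))\<^sup>2)" .
  qed
  also have "\<dots> = (norm A)\<^sup>2 * (\<Sum>v\<in>V. \<Sum>w\<in>G v. (norm (?E w x))\<^sup>2)"
    by (simp add: sum_distrib_left)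
  \<comment> \<open>After exchanging the sums, the term for w occurs once for each v paired with it,
    hence at most K times. The estimate is one of squared norms, whence \<open>sqrt (real K)\<close>
    in the bound.\<close>
  also have "(\<Sum>v\<in>V. \<Sum>w\<in>G v. (norm (?E w x))\<^sup>2)
      = (\<Sum>w\<in>W. \<Sum>v\<in>{v\<in>V. (v, w) \<in> F}. (norm (?E w x))\<^sup>2)"
    unfolding G_def using fin by (intro sum.swap_restrict)
  also have "\<dots> \<le> (\<Sum>w\<in>W. real K * (norm (?E w x))\<^sup>2)"
  proof (rule sum_mono)
    fix w
    have "{v\<in>V. (v, w) \<in> F} = {v. (v, w) \<in> F}"
      by (force simp: V_def)
    then show "(\<Sum>v\<in>{v\<in>V. (v, w) \<in> F}. (norm (?E w x))\<^sup>2) \<le> real K * (norm (?E w x))\<^sup>2"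
      using K[of w] by (simp add: mult_right_mono)
  qed
  also have "\<dots> \<le> real K * (norm x)\<^sup>2"
    unfolding sum_distrib_left[symmetric] using fin sub
    by (intro mult_left_mono eigenproj_bessel[OF U cs]) auto
  finally have "(norm (\<Sum>v\<in>V. ?E v (y v)))\<^sup>2 \<le> (norm A)\<^sup>2 * (real K * (norm x)\<^sup>2)"
    by (simp add: mult_left_mono)
  also have "\<dots> = (norm A * sqrt (real K) * norm x)\<^sup>2"
    by (simp add: power_mult_distrib)
  finally show ?thesis
    unfolding eq by (rule power2_le_imp_le) simp
qed

text \<open>This is the mean ergodic theorem for the unitary c U^k, whose fixed space in a compact
  system is the sum of the eigenspaces with c v^k = 1. As k is nonzero, at most
  \<open>\<bar>k\<bar>\<close> eigenvalues v qualify.\<close>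

lemma twisted_cesaro_mean_tendsto:
  assumes U: "unitary_op U" and cs: "compact_system U"
    and k: "k \<noteq> 0" and c: "norm c = 1"
  shows "(\<lambda>N. (1 / real N) *\<^sub>R (\<Sum>n<N. c ^ n *\<^sub>C blinfun_apply (op_powi U (int n * k)) y))
     \<longlonglongrightarrow> (\<Sum>v\<in>{v\<in>sigma_pp U. v powi k * c = 1}. blinfun_apply (eigenproj U v) y)"
proof (rule strong_limit_from_total[where D="eigenvectors U" and C=1 and x=y
      and S="\<lambda>y. \<Sum>v\<in>{v\<in>sigma_pp U. v powi k * c = 1}. blinfun_apply (eigenproj U v) y"
      and T="\<lambda>N y. (1 / real N) *\<^sub>R
        (\<Sum>n<N. c ^ n *\<^sub>C blinfun_apply (op_powi U (int n * k)) y)"])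
  let ?V = "{v\<in>sigma_pp U. v powi k * c = 1}"
  let ?Q = "\<lambda>y. \<Sum>v\<in>?V. blinfun_apply (eigenproj U v) y"
  have "c \<noteq> 0"
    using c by auto
  then have "?V \<subseteq> {v. v powi k = inverse c}"
    by (auto simp: field_simps)
  \<comment> \<open>Finiteness is essential to the form of the limit, since \<open>sum\<close> over
    an infinite set is 0 by default.\<close>
  then have fin: "finite ?V"
    using finite_card_power_int_eq(1)[OF k, of "inverse c"] \<open>c \<noteq> 0\<close> finite_subset by auto
  show "closed_cspan (eigenvectors U) = UNIV"
    using cs by (simp add: compact_system_def)
  show "complex_linear ?Q"
    using eigenproj_compact(1)[OF U cs] by (intro complex_linear_sum) (auto simp: bounded_ops_iff)
  show "bounded_linear ?Q"
    by (intro bounded_linear_sum blinfun.bounded_linear_right)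
  show "(\<lambda>N. (1 / real N) *\<^sub>R (\<Sum>n<N. c ^ n *\<^sub>C blinfun_apply (op_powi U (int n * k)) x))
     \<longlonglongrightarrow> ?Q x" if "x \<in> eigenvectors U" for x
  proof -
    from that obtain v where v: "v \<in> sigma_pp U" "x \<in> eigenspace U v"
      by (rule eigenvectorsE)
    have "?Q x = (\<Sum>u\<in>?V. if v = u then x else 0)"
      using eigenproj_eigenvector[OF U cs _ v] by (intro sum.cong) auto
    also have "\<dots> = (if c * v powi k = 1 then x else 0)"
      using fin v(1) by (simp add: mult.commute)
    finally show ?thesis
      using twisted_cesaro_mean_eigenvector[OF U c v, of k] by simp
  qed
qed (use complex_linear_twisted_cesaro_mean[OF U] norm_twisted_cesaro_mean[OF U c] in auto)

text \<open>The inner projections annihilate x except the one for w, which fixes it; only the slice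
  of F at w survives.\<close>

lemma sum_eigenproj_eigenvector:
  assumes U: "unitary_op U" and cs: "compact_system U"
    and F: "finite F" "F \<subseteq> sigma_pp U \<times> sigma_pp U"
    and w: "w \<in> sigma_pp U" "x \<in> eigenspace U w"
  shows "(\<Sum>(v, w)\<in>F. blinfun_apply (eigenproj U v o\<^sub>L A o\<^sub>L eigenproj U w) x)
     = (\<Sum>v\<in>{v. (v, w) \<in> F}. blinfun_apply (eigenproj U v) (blinfun_apply A x))"
proof -
  let ?h = "\<lambda>v. blinfun_apply (eigenproj U v) (blinfun_apply A x)"
  have "(\<Sum>(v, w)\<in>F. blinfun_apply (eigenproj U v o\<^sub>L A o\<^sub>L eigenproj U w) x)
      = (\<Sum>p\<in>F. if snd p = w then ?h (fst p) else 0)"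
    using F(2) eigenproj_eigenvector[OF U cs _ w] by (intro sum.cong) auto
  also have "\<dots> = (\<Sum>p\<in>{p\<in>F. snd p = w}. ?h (fst p))"
    using F(1) by (simp add: sum.inter_filter)
  also have "{p\<in>F. snd p = w} = (\<lambda>v. (v, w)) ` {v. (v, w) \<in> F}"
    by auto
  also have "(\<Sum>p\<in>\<dots>. ?h (fst p)) = (\<Sum>v\<in>{v. (v, w) \<in> F}. ?h v)"
    by (subst sum.reindex) (auto simp: inj_on_def)
  finally show ?thesis .
qed

lemma sum_blinfun_apply_case_prod:
  "blinfun_apply (\<Sum>(v, w)\<in>F. f v w) x = (\<Sum>(v, w)\<in>F. blinfun_apply (f v w) x)"
  by (simp add: blinfun.sum_left case_prod_beta)

theorem theorem7p2:
  fixes k1 k2 :: int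
    and \<alpha> :: "'a::unital_cstar_algebra \<Rightarrow> 'a"
    and \<omega> :: "'a \<Rightarrow> complex"
    and \<pi> :: "'a \<Rightarrow> ('h::complex_hilbert \<Rightarrow>\<^sub>L 'h)"
    and U :: "'h \<Rightarrow>\<^sub>L 'h"
    and \<Omega> :: 'h
  assumes "k1 \<noteq> 0" and "k2 \<noteq> 0" and "k1 \<noteq> k2"
    and "cstar_dynamical_system \<alpha> \<omega>"
    and "covariant_GNS \<alpha> \<omega> \<pi> U \<Omega>"
    and "compact_system U"
  shows "\<forall>A\<in>bounded_ops. \<exists>S\<in>bounded_ops.
    sot_has_sum (\<lambda>(v, w). eigenproj U v o\<^sub>L A o\<^sub>L eigenproj U w)
      {(v, w). v \<in> sigma_pp U \<and> w \<in> sigma_pp U \<and> v powi k1 * w powi (k2 - k1) = 1} S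
    \<and> limitin strong_operator_topology
        (\<lambda>N. (1 / real N) *\<^sub>R
          (\<Sum>n<N. op_powi U (int n * k1) o\<^sub>L A o\<^sub>L op_powi U (int n * (k2 - k1))))
        S sequentially"
proof
  fix A :: "'h \<Rightarrow>\<^sub>L 'h"
  assume A: "A \<in> bounded_ops"
  have U: "unitary_op U"
    using assms(5) by (simp add: covariant_GNS_def)
  note cs = assms(6)
  have D: "closed_cspan (eigenvectors U) = UNIV"
    using cs by (simp add: compact_system_def)
  have lA: "complex_linear (blinfun_apply A)"
    using A by (simp add: bounded_ops_iff)
  let ?I = "{(v, w). v \<in> sigma_pp U \<and> w \<in> sigma_pp U \<and> v powi k1 * w powi (k2 - k1) = 1}"
  let ?c = "\<lambda>w. w powi (k2 - k1)"
  let ?V = "\<lambda>w. {v\<in>sigma_pp U. v powi k1 * ?c w = 1}"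
  let ?f = "\<lambda>(v, w). eigenproj U v o\<^sub>L A o\<^sub>L eigenproj U w"
  have norm_c: "norm (?c w) = 1" if "w \<in> sigma_pp U" for w
    using sigma_pp_norm[OF U that] by (simp add: norm_power_int)
  \<comment> \<open>The partners v of w are solutions of \<open>v powi k1 = inverse (?c w)\<close>;
    this is where \<open>k1\<close> being nonzero enters.\<close>
  have V_bound: "finite (?V w) \<and> card (?V w) \<le> nat \<bar>k1\<bar>" if "w \<in> sigma_pp U" for w
  proof -
    have "?c w \<noteq> 0"
      using norm_c[OF that] by force
    then have sub: "?V w \<subseteq> {v. v powi k1 = inverse (?c w)}" and "inverse (?c w) \<noteq> 0"
      by (auto simp: field_simps)
    note roots = finite_card_power_int_eq[OF assms(1) this(2)]
    show ?thesis
      using finite_subset[OF sub roots(1)] card_mono[OF roots(1) sub] by (simp only: roots(2))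
  qed
  have card_bound: "card {v. (v, w) \<in> F} \<le> nat \<bar>k1\<bar>" if "F \<subseteq> ?I" for F w
  proof (cases "w \<in> sigma_pp U")
    case True
    have "{v. (v, w) \<in> F} \<subseteq> ?V w"
      using that by auto
    then show ?thesis
      using V_bound[OF True] card_mono order_trans by blast
  next
    case False
    then have "{v. (v, w) \<in> F} = {}"
      using that by auto
    then show ?thesis by simp
  qed
  \<comment> \<open>Linearity and the bound are required for every F, whereas the net eventually
    consists of finite subsets of the index set. Intersecting with that set makes the estimates hold
    throughout; if the intersection is infinite, the sum is 0.\<close>
  define T where "T = (\<lambda>F x. blinfun_apply (sum ?f (F \<inter> ?I)) x)"
  let ?net = "finite_subsets_at_top ?I"
  have T_eq: "eventually (\<lambda>F. T F x = blinfun_apply (sum ?f F) x) ?net" for x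
    by (rule eventually_finite_subsets_at_top_weakI) (simp add: T_def Int_absorb2)
  have T_eig: "((\<lambda>F. T F x) \<longlongrightarrow> (\<Sum>v\<in>?V w. blinfun_apply (eigenproj U v) (blinfun_apply A x))) ?net"
    if w: "w \<in> sigma_pp U" "x \<in> eigenspace U w" for w x
  proof (rule tendsto_eventually)
    \<comment> \<open>As soon as F contains the finitely many admissible pairs with second entry w,
      its slice at w is exactly \<open>?V w\<close>.\<close>
    have "eventually (\<lambda>F. finite F \<and> (\<lambda>v. (v, w)) ` ?V w \<subseteq> F \<and> F \<subseteq> ?I) ?net"
      using w V_bound[OF w(1)] unfolding eventually_finite_subsets_at_top
      by (intro exI[of _ "(\<lambda>v. (v, w)) ` ?V w"]) auto
    then show "eventually (\<lambda>F. T F x =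
        (\<Sum>v\<in>?V w. blinfun_apply (eigenproj U v) (blinfun_apply A x))) ?net"
    proof eventually_elim
      case (elim F)
      then have "F \<inter> ?I = F" "{v. (v, w) \<in> F} = ?V w" "F \<subseteq> sigma_pp U \<times> sigma_pp U"
        by auto
      then show ?case
        using elim sum_eigenproj_eigenvector[OF U cs _ _ w, of F A]
        by (simp add: T_def sum_blinfun_apply_case_prod)
    qed
  qed
  let ?C = "norm A * sqrt (real (nat \<bar>k1\<bar>))"
  have T_lin: "complex_linear (T F)" for F
    unfolding T_def bounded_ops_iff[symmetric]
    by (intro bounded_ops_sum) (auto intro!: bounded_ops_compose A eigenproj_compact(1)[OF U cs])
  have T_bd: "norm (T F x) \<le> ?C * norm x" for F x
  proof (cases "finite (F \<inter> ?I)")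
    case True
    then show ?thesis
      unfolding T_def sum_blinfun_apply_case_prod
      by (intro norm_sum_eigenproj_le[OF U cs] card_bound) auto
  qed (simp add: T_def)
  have T_conv: "\<exists>l. ((\<lambda>F. T F x) \<longlongrightarrow> l) ?net" if "x \<in> eigenvectors U" for x
    by (rule eigenvectorsE[OF that]) (use T_eig in blast)
  obtain S where S: "complex_linear S" "\<And>x. norm (S x) \<le> ?C * norm x"
    "\<And>x. ((\<lambda>F. T F x) \<longlongrightarrow> S x) ?net"
    using strong_limit_exists[where T=T, OF finite_subsets_at_top_neq_bot T_lin T_bd D T_conv] by blast
  have S_eig: "S x = (\<Sum>v\<in>?V w. blinfun_apply (eigenproj U v) (blinfun_apply A x))"
    if "w \<in> sigma_pp U" "x \<in> eigenspace U w" for w x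
    using tendsto_unique[OF _ S(3) T_eig[OF that]] by simp
  have bS: "bounded_linear S"
    by (rule complex_linear_imp_bounded_linear[OF S(1,2)])
  let ?M = "\<lambda>N. (1 / real N) *\<^sub>R
    (\<Sum>n<N. op_powi U (int n * k1) o\<^sub>L A o\<^sub>L op_powi U (int n * (k2 - k1)))"
  have M_apply: "blinfun_apply (?M N) = (\<lambda>x. (1 / real N) *\<^sub>R (\<Sum>n<N.
      blinfun_apply (op_powi U (int n * k1))
        (blinfun_apply A (blinfun_apply (op_powi U (int n * (k2 - k1))) x))))" for N
    by (simp add: fun_eq_iff blinfun.scaleR_left blinfun.sum_left)
  have M_lim: "(\<lambda>N. blinfun_apply (?M N) x) \<longlonglongrightarrow> S x" for x
  proof (rule strong_limit_from_total[where T="\<lambda>N. blinfun_apply (?M N)" and x=x,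
        OF _ _ _ D S(1) bS])
    show "complex_linear (blinfun_apply (?M N))" for N
      using complex_linear_op_powi[OF U] unfolding bounded_ops_iff[symmetric]
      by (intro bounded_ops_scaleR bounded_ops_sum bounded_ops_compose A)
    show "norm (blinfun_apply (?M N) x) \<le> norm A * norm x" for N x
      unfolding M_apply
      using norm_blinfun[of A] norm_op_powi[OF U]
      by (intro norm_cesaro_mean_le) (metis, simp)
  next
    fix x assume "x \<in> eigenvectors U"
    then obtain w where w: "w \<in> sigma_pp U" "x \<in> eigenspace U w"
      by (rule eigenvectorsE)
    have "blinfun_apply (op_powi U (int n * k1))
        (blinfun_apply A (blinfun_apply (op_powi U (int n * (k2 - k1))) x))
      = ?c w ^ n *\<^sub>C blinfun_apply (op_powi U (int n * k1)) (blinfun_apply A x)" for n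
    proof -
      \<comment> \<open>The right-hand power acts on x as a scalar, which passes through A and the
        left-hand power and becomes the twist \<open>?c w\<close>.\<close>
      have "w powi (int n * (k2 - k1)) = ?c w ^ n"
        by (simp add: power_int_power' mult.commute)
      then show ?thesis
        by (simp add: op_powi_eigenvector[OF U w] complex_linear_scaleC[OF lA]
            complex_linear_scaleC[OF complex_linear_op_powi[OF U]])
    qed
    \<comment> \<open>The ergodic limit at \<open>A x\<close> with twist \<open>?c w\<close> and
      exponent \<open>k1\<close> is the same finite sum over \<open>?V w\<close> that the series
      yields at x.\<close>
    then show "(\<lambda>N. blinfun_apply (?M N) x) \<longlonglongrightarrow> S x"
      unfolding M_apply S_eig[OF w]
      using twisted_cesaro_mean_tendsto[OF U cs assms(1) norm_c[OF w(1)]] by simp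
  qed simp
  have BS: "blinfun_apply (Blinfun S) = S"
    by (rule bounded_linear_Blinfun_apply[OF bS])
  have "sot_has_sum ?f ?I (Blinfun S)"
    unfolding sot_has_sum_def
    by (rule limitin_strong_operator_topologyI)
       (use Lim_transform_eventually[OF S(3) T_eq] in \<open>simp only: BS\<close>)
  moreover have "limitin strong_operator_topology ?M (Blinfun S) sequentially"
    by (rule limitin_strong_operator_topologyI) (use M_lim in \<open>simp only: BS\<close>)
  moreover have "Blinfun S \<in> bounded_ops"
    using S(1) by (simp add: bounded_ops_iff BS)
  ultimately show "\<exists>S\<in>bounded_ops. sot_has_sum ?f ?I S
      \<and> limitin strong_operator_topology ?M S sequentially"
    by blast
qed

end
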